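(* Let $\Gamma$ be a discrete countable group with a length function $L$. Let $\alpha:\Gamma\curvearrowright(X,m)$ be a measurable action on a $\sigma$-finite measured space $(X,m)$, where $m$ is a nonzero $\Gamma$-quasi-invariant measure, and let $\pi_\alpha:\Gamma\to U(L^2(X,m))$ be the unitary representation associated to this action. Assume that $\Gamma$ contains a cyclic subgroup of exponential growth with respect to $L$. Then there exists $\xi\in L^2(X,m)_+$ such that for all $d\ge 1$ we have $$\sum_{\gamma\in\Gamma}\frac{\langle\pi_\alpha(\gamma)\xi,\xi\rangle^2}{(1+L(\gamma))^d}=\infty.$$
   Context: A length function on a discrete group $\Gamma$ is a function $L:\Gamma\to\mathbb{R}_+$ with $L(e)=0$, $L(g^{-1})=L(g)$ and $L(gh)\le L(g)+L(h)$ for all $g,h\in\Gamma$. For $\gamma\in\Gamma$, $\gamma_*m(A)=m(\gamma^{-1}A)$; $m$ is $\Gamma$-quasi-invariant if $\gamma_*m$ and $m$ have the same null sets for every $\gamma\in\Gamma$. The representation $\pi_\alpha$ is $$(\pi_\alpha(\gamma)\xi)(x)=\left(\frac{d\gamma_*m}{dm}(x)\right)^{1/2}\xi(\gamma^{-1}\cdot x).$$ $L^2(X,m)_+=\{\xi\in L^2(X,m):\xi\ge0\ m\text{-almost everywhere}\}$. A subgroup $Z\subset\Gamma$ has exponential growth with respect to $L$ if there exist $a>1$ and $c>0$ such that $\#\{z\in Z: L(z)\le R\}\ge c\,a^R$ for all sufficiently large $R$. *)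

theory Defs
  imports "HOL-Analysis.Analysis" "HOL-Algebra.Algebra"
begin

section \<open>Length functions and exponential growth\<close>

definition length_function :: "('g, 'r) monoid_scheme \<Rightarrow> ('g \<Rightarrow> real) \<Rightarrow> bool" where
  "length_function G L \<longleftrightarrow>
     (\<forall>g\<in>carrier G. 0 \<le> L g) \<and>
     L \<one>\<^bsub>G\<^esub> = 0 \<and>
     (\<forall>g\<in>carrier G. L (inv\<^bsub>G\<^esub> g) = L g) \<and>
     (\<forall>g\<in>carrier G. \<forall>h\<in>carrier G. L (g \<otimes>\<^bsub>G\<^esub> h) \<le> L g + L h)"

text \<open>A length function need not be proper, so balls may be infinite. An infinite ball
  exceeds every bound, whereas \<^const>\<open>card\<close> assigns it the value 0; this is why the
  inequality is only imposed on finite balls.\<close>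

definition exponential_growth :: "('g \<Rightarrow> real) \<Rightarrow> 'g set \<Rightarrow> bool" where
  "exponential_growth L Z \<longleftrightarrow>
     (\<exists>a c :: real. a > 1 \<and> c > 0 \<and>
       (\<forall>\<^sub>F R in at_top. finite {z\<in>Z. L z \<le> R} \<longrightarrow>
          real (card {z\<in>Z. L z \<le> R}) \<ge> c * a powr R))"


section \<open>Measurable actions and the associated representation\<close>

text \<open>The acting group is countable and discrete, so joint measurability of the action
  amounts to measurability of each of its maps.\<close>

definition measurable_action ::
  "('g, 'r) monoid_scheme \<Rightarrow> 'x measure \<Rightarrow> ('g \<Rightarrow> 'x \<Rightarrow> 'x) \<Rightarrow> bool" where
  "measurable_action G M \<alpha> \<longleftrightarrow>
     group_action G (space M) \<alpha> \<and> (\<forall>g\<in>carrier G. \<alpha> g \<in> measurable M M)"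

text \<open>\<open>translate M \<alpha> g\<close> is the measure sending \<open>A\<close> to the \<open>M\<close>-measure of the preimage
  of \<open>A\<close> under \<open>\<alpha> g\<close>, i.e. of the translate of \<open>A\<close> by the inverse of \<open>g\<close>.\<close>

definition translate :: "'x measure \<Rightarrow> ('g \<Rightarrow> 'x \<Rightarrow> 'x) \<Rightarrow> 'g \<Rightarrow> 'x measure" where
  "translate M \<alpha> g = distr M M (\<alpha> g)"

definition quasi_invariant ::
  "('g, 'r) monoid_scheme \<Rightarrow> 'x measure \<Rightarrow> ('g \<Rightarrow> 'x \<Rightarrow> 'x) \<Rightarrow> bool" where
  "quasi_invariant G M \<alpha> \<longleftrightarrow>
     (\<forall>g\<in>carrier G. null_sets (translate M \<alpha> g) = null_sets M)"

text \<open>Elements of the complex Hilbert space are handled through representatives: functions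
  equal almost everywhere stand for the same vector, and (for a quasi-invariant measure)
  everything below depends only on the class.\<close>

definition L2 :: "'x measure \<Rightarrow> ('x \<Rightarrow> complex) set" where
  "L2 M = {\<xi> \<in> borel_measurable M. integrable M (\<lambda>x. (norm (\<xi> x))\<^sup>2)}"

definition L2_pos :: "'x measure \<Rightarrow> ('x \<Rightarrow> complex) set" where
  "L2_pos M = {\<xi> \<in> L2 M. AE x in M. \<xi> x \<in> \<real>\<^sub>\<ge>\<^sub>0}"

definition L2_inner :: "'x measure \<Rightarrow> ('x \<Rightarrow> complex) \<Rightarrow> ('x \<Rightarrow> complex) \<Rightarrow> complex" where
  "L2_inner M \<xi> \<eta> = (LINT x|M. \<xi> x * cnj (\<eta> x))"

text \<open>\<^const>\<open>RN_deriv\<close> takes the reference measure first.\<close>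

definition koopman ::
  "('g, 'r) monoid_scheme \<Rightarrow> 'x measure \<Rightarrow> ('g \<Rightarrow> 'x \<Rightarrow> 'x) \<Rightarrow> 'g \<Rightarrow> ('x \<Rightarrow> complex) \<Rightarrow> 'x \<Rightarrow> complex"
  where
  "koopman G M \<alpha> g \<xi> x =
     complex_of_real (sqrt (enn2real (RN_deriv M (translate M \<alpha> g) x))) * \<xi> (\<alpha> (inv\<^bsub>G\<^esub> g) x)"

text \<open>For a positive vector the matrix coefficients are nonnegative reals, so taking the real
  part of such a coefficient, or of its square, loses nothing.\<close>

lemma koopman_coefficient_nonneg:
  assumes "group G" "measurable_action G M \<alpha>" "quasi_invariant G M \<alpha>"
    and g: "g \<in> carrier G" and \<xi>: "\<xi> \<in> L2_pos M"
  shows "L2_inner M (koopman G M \<alpha> g \<xi>) \<xi> \<in> \<real>\<^sub>\<ge>\<^sub>0"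
proof -
  interpret group G by fact
  let ?h = "inv\<^bsub>G\<^esub> g"
  have h: "?h \<in> carrier G" using g by simp
  have meas: "\<alpha> ?h \<in> measurable M M"
    using assms(2) h by (auto simp: measurable_action_def)
  have pos: "AE x in M. \<xi> x \<in> \<real>\<^sub>\<ge>\<^sub>0"
    using \<xi> by (simp add: L2_pos_def)
  have "null_sets (distr M M (\<alpha> ?h)) = null_sets M"
    using assms(3) h by (auto simp: quasi_invariant_def translate_def)
  then have "AE x in distr M M (\<alpha> ?h). \<xi> x \<in> \<real>\<^sub>\<ge>\<^sub>0"
    using pos by (simp add: eventually_ae_filter)
  then have pos': "AE x in M. \<xi> (\<alpha> ?h x) \<in> \<real>\<^sub>\<ge>\<^sub>0"
    using meas by (rule AE_distrD[rotated])
  let ?f = "\<lambda>x. koopman G M \<alpha> g \<xi> x * cnj (\<xi> x)"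
  have nn: "AE x in M. ?f x \<in> \<real>\<^sub>\<ge>\<^sub>0"
    using pos pos'
    by eventually_elim (auto simp: koopman_def complex_nonneg_Reals_iff)
  show ?thesis
  proof (cases "integrable M ?f")
    case True
    have "(LINT x|M. Im (?f x)) = 0"
      using nn by (intro integral_eq_zero_AE) (auto simp: complex_nonneg_Reals_iff)
    then have im: "Im (integral\<^sup>L M ?f) = 0"
      using integral_Im[OF True] by argo
    have "0 \<le> (LINT x|M. Re (?f x))"
      using nn by (intro integral_nonneg_AE) (auto simp: complex_nonneg_Reals_iff)
    then have "0 \<le> Re (integral\<^sup>L M ?f)"
      using integral_Re[OF True] by argo
    with im show ?thesis
      by (simp add: L2_inner_def complex_nonneg_Reals_iff)
  next
    case False
    then show ?thesis by (simp add: L2_inner_def not_integrable_integral_eq)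
  qed
qed

end

theory Submission
  imports Defs "HOL-Real_Asymp.Real_Asymp"
begin

text \<open>Take \<open>\<xi> = sqrt h\<close> for an integrable density \<open>h \<ge> 0\<close>. Then \<open>\<pi>(\<gamma>)\<xi>\<close> is the square root of
  the density of the image under \<open>\<gamma>\<close> of the measure \<open>h m\<close>, and \<open>sqrt (a b) \<ge> min a b\<close> bounds the
  coefficient \<open>\<langle>\<pi>(\<gamma>)\<xi>, \<xi>\<rangle>\<close> from below by the mass that \<open>h m\<close> and its image have in common.
  If \<open>h m\<close> is the average of the images of a probability measure under \<open>1, z, \<dots>, z\<^sup>K\<^sup>-\<^sup>1\<close>, where \<open>z\<close>
  generates the cyclic subgroup, then the common mass for \<open>\<gamma> = z\<^sup>n\<close> is at least
  \<open>(K - n) / K \<ge> 1/2\<close> as soon as \<open>2 n \<le> K\<close>. Summing such averages with weights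
  \<open>2\<^sup>-\<^sup>j\<^sup>-\<^sup>1\<close> and lengths \<open>K\<^sub>j\<close> that grow as fast as we please, the coefficients are at least
  \<open>2\<^sup>-\<^sup>j\<^sup>-\<^sup>2\<close> on exponentially many (at least \<open>c a^(j\<^sup>2)\<close>) powers of \<open>z\<close> of length at most
  \<open>j\<^sup>2\<close>. Since \<open>a^(j\<^sup>2)\<close> beats \<open>4^j (1 + j\<^sup>2)^d\<close>, the series diverges.\<close>

section \<open>Square roots of extended nonnegative densities\<close>

definition sqrt_density :: "('x \<Rightarrow> ennreal) \<Rightarrow> 'x \<Rightarrow> complex" where
  "sqrt_density h x = complex_of_real (sqrt (enn2real (h x)))"

text \<open>Equality fails only at infinity, which \<open>enn2real\<close> sends to 0.\<close>

lemma ennreal_sqrt_square_le: "ennreal ((sqrt (enn2real a))\<^sup>2) \<le> a"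
  by (cases a) auto

text \<open>By the inequality of means. The sum serves as an integrable majorant for the integrand
  of a matrix coefficient.\<close>

lemma ennreal_sqrt_mult_le_add: "ennreal (sqrt (enn2real a) * sqrt (enn2real b)) \<le> a + b"
proof (cases a; cases b)
  fix r s assume *: "0 \<le> r" "a = ennreal r" "0 \<le> s" "b = ennreal s"
  have "sqrt r * sqrt s \<le> r + s"
    using arith_geo_mean_sqrt[of r s] * by (auto simp: real_sqrt_mult)
  then show ?thesis using * by (auto simp flip: ennreal_plus)
qed auto

text \<open>Finiteness matters: for infinite \<open>a\<close> the right-hand side is 0, whereas the
  minimum is \<open>b\<close>.\<close>

lemma min_le_ennreal_sqrt_mult:
  assumes "a \<noteq> \<infinity>" "b \<noteq> \<infinity>"
  shows "min a b \<le> ennreal (sqrt (enn2real a) * sqrt (enn2real b))"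
proof (cases a; cases b)
  fix r s assume *: "0 \<le> r" "a = ennreal r" "0 \<le> s" "b = ennreal s"
  have "min r s = sqrt (min r s) * sqrt (min r s)"
    using * by (simp add: min_def)
  also have "\<dots> \<le> sqrt r * sqrt s"
    using * by (intro mult_mono) auto
  finally have "ennreal (min r s) \<le> ennreal (sqrt r * sqrt s)" by (rule ennreal_leI)
  then show ?thesis using * by (auto simp: min_def split: if_splits)
qed (use assms in auto)

section \<open>Transport of densities by the action\<close>

locale quasi_invariant_action = group G + sigma_finite_measure M
  for G :: "('g, 'r) monoid_scheme" (structure) and M :: "'x measure" +
  fixes \<alpha> :: "'g \<Rightarrow> 'x \<Rightarrow> 'x"
  assumes action: "measurable_action G M \<alpha>"
    and quasi_inv: "quasi_invariant G M \<alpha>"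
begin

lemma measurable_act [measurable]: "g \<in> carrier G \<Longrightarrow> \<alpha> g \<in> measurable M M"
  using action by (auto simp: measurable_action_def)

lemma act_mult:
  "g \<in> carrier G \<Longrightarrow> h \<in> carrier G \<Longrightarrow> x \<in> space M \<Longrightarrow> \<alpha> (g \<otimes> h) x = \<alpha> g (\<alpha> h x)"
  using action group_action.composition_rule by (fastforce simp: measurable_action_def)

lemma act_one: "x \<in> space M \<Longrightarrow> \<alpha> \<one> x = x"
  using action group_action.id_eq_one by (metis measurable_action_def restrict_apply')

lemma density_RN_deriv_translate:
  assumes "g \<in> carrier G"
  shows "density M (RN_deriv M (translate M \<alpha> g)) = translate M \<alpha> g"
  using assms quasi_inv
  by (intro density_RN_deriv)
     (auto simp: absolutely_continuous_def quasi_invariant_def translate_def)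

text \<open>For measurable \<open>f\<close>, a density of the image under \<open>g\<close> of the
  measure with density \<open>f\<close>.\<close>

definition push :: "'g \<Rightarrow> ('x \<Rightarrow> ennreal) \<Rightarrow> 'x \<Rightarrow> ennreal" where
  "push g f x = RN_deriv M (translate M \<alpha> g) x * f (\<alpha> (inv g) x)"

lemma measurable_push [measurable]:
  assumes "g \<in> carrier G" "f \<in> borel_measurable M"
  shows "push g f \<in> borel_measurable M"
proof -
  have [measurable]: "\<alpha> (inv g) \<in> measurable M M" "f \<in> borel_measurable M"
    using assms by auto
  show ?thesis unfolding push_def[abs_def] by measurable
qed

text \<open>The Radon-Nikodym factor turns \<open>M\<close> into its image under \<open>g\<close>; a
  change of variables then pulls the remaining factor back to \<open>f\<close>, because
  \<open>inv g\<close> undoes \<open>g\<close>.\<close>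

lemma density_push:
  assumes g: "g \<in> carrier G" and f: "f \<in> borel_measurable M"
  shows "density M (push g f) = distr (density M f) M (\<alpha> g)"
proof -
  have [measurable]: "\<alpha> (inv g) \<in> measurable M M" "\<alpha> g \<in> measurable M M" "f \<in> borel_measurable M"
    using g f by auto
  have "density M (push g f) =
      density (density M (RN_deriv M (translate M \<alpha> g))) (\<lambda>x. f (\<alpha> (inv g) x))"
    unfolding push_def[abs_def] by (subst density_density_eq) auto
  also have "\<dots> = density (distr M M (\<alpha> g)) (\<lambda>x. f (\<alpha> (inv g) x))"
    using g by (simp add: density_RN_deriv_translate) (simp add: translate_def)
  also have "\<dots> = distr (density M (\<lambda>x. f (\<alpha> (inv g) (\<alpha> g x)))) M (\<alpha> g)"
    by (rule density_distr) auto
  also have "density M (\<lambda>x. f (\<alpha> (inv g) (\<alpha> g x))) = density M f"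
    using g by (intro density_cong) (auto simp: act_one simp flip: act_mult)
  finally show ?thesis .
qed

lemma nn_integral_push:
  assumes g: "g \<in> carrier G" and f: "f \<in> borel_measurable M"
  shows "(\<integral>\<^sup>+x. push g f x \<partial>M) = (\<integral>\<^sup>+x. f x \<partial>M)"
proof -
  have "emeasure (density M (push g f)) (space M) = emeasure (density M f) (space M)"
    using g f measurable_space[OF measurable_act[OF g]]
    by (subst density_push) (auto simp: emeasure_distr intro!: arg_cong2[where f=emeasure])
  then show ?thesis
    using g f by (simp add: emeasure_density cong: nn_integral_cong)
qed

text \<open>Both sides are densities of the same image measure, and densities are unique up to null
  sets. This replaces a chain rule for Radon-Nikodym derivatives.\<close>

lemma push_push:
  assumes g: "g \<in> carrier G" and h: "h \<in> carrier G" and f: "f \<in> borel_measurable M"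
  shows "AE x in M. push g (push h f) x = push (g \<otimes> h) f x"
proof (rule density_unique)
  have "density M (push g (push h f)) = distr (distr (density M f) M (\<alpha> h)) M (\<alpha> g)"
    using assms by (simp add: density_push)
  also have "\<dots> = distr (density M f) M (\<alpha> g \<circ> \<alpha> h)"
    using g h by (intro distr_distr) auto
  also have "\<dots> = distr (density M f) M (\<alpha> (g \<otimes> h))"
    using g h by (intro distr_cong) (auto simp: act_mult)
  also have "\<dots> = density M (push (g \<otimes> h) f)"
    using assms by (simp add: density_push)
  finally show "density M (push g (push h f)) = density M (push (g \<otimes> h) f)" .
qed (use assms in auto)

lemma push_mono: "(\<And>x. f x \<le> f' x) \<Longrightarrow> push g f x \<le> push g f' x"
  by (simp add: push_def mult_left_mono)

lemma push_cmult: "push g (\<lambda>x. c * f x) x = c * push g f x"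
  by (simp add: push_def mult_ac)

lemma push_sum: "push g (\<lambda>x. \<Sum>i\<in>I. f i x) x = (\<Sum>i\<in>I. push g (f i) x)"
  by (simp add: push_def sum_distrib_left)

section \<open>Matrix coefficients of square-root vectors\<close>

lemma sqrt_density_in_L2_pos:
  assumes h [measurable]: "h \<in> borel_measurable M" and fin: "(\<integral>\<^sup>+x. h x \<partial>M) < \<infinity>"
  shows "sqrt_density h \<in> L2_pos M"
proof -
  have "(\<integral>\<^sup>+x. ennreal ((sqrt (enn2real (h x)))\<^sup>2) \<partial>M) \<le> (\<integral>\<^sup>+x. h x \<partial>M)"
    by (intro nn_integral_mono ennreal_sqrt_square_le)
  then have "integrable M (\<lambda>x. (sqrt (enn2real (h x)))\<^sup>2)"
    using fin by (intro integrableI_nonneg) auto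
  moreover have "sqrt_density h \<in> borel_measurable M"
    unfolding sqrt_density_def[abs_def] by measurable
  ultimately show ?thesis
    by (auto simp: L2_pos_def L2_def sqrt_density_def complex_nonneg_Reals_iff)
qed

lemma koopman_coefficient_ge:
  assumes h [measurable]: "h \<in> borel_measurable M" and fin: "(\<integral>\<^sup>+x. h x \<partial>M) < \<infinity>"
    and g: "g \<in> carrier G" and p: "ennreal p \<le> (\<integral>\<^sup>+x. min (push g h x) (h x) \<partial>M)"
  shows "p \<le> Re (L2_inner M (koopman G M \<alpha> g (sqrt_density h)) (sqrt_density h))"
proof -
  have [measurable]: "push g h \<in> borel_measurable M" using g h by simp
  have fin': "(\<integral>\<^sup>+x. push g h x \<partial>M) < \<infinity>"
    using fin g h by (simp add: nn_integral_push)
  let ?k = "\<lambda>x. sqrt (enn2real (push g h x)) * sqrt (enn2real (h x))"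
  have "koopman G M \<alpha> g (sqrt_density h) x * cnj (sqrt_density h x) = complex_of_real (?k x)" for x
    by (simp add: koopman_def sqrt_density_def push_def enn2real_mult real_sqrt_mult)
  then have inner: "L2_inner M (koopman G M \<alpha> g (sqrt_density h)) (sqrt_density h)
      = complex_of_real (integral\<^sup>L M ?k)"
    unfolding L2_inner_def by (simp only: integral_complex_of_real)
  \<comment> \<open>This makes \<open>?k\<close> integrable; otherwise its Bochner integral would
    default to 0.\<close>
  have "(\<integral>\<^sup>+x. ennreal (?k x) \<partial>M) \<le> (\<integral>\<^sup>+x. push g h x + h x \<partial>M)"
    by (intro nn_integral_mono ennreal_sqrt_mult_le_add)
  also have "\<dots> < \<infinity>"
    using fin fin' by (simp add: nn_integral_add)
  finally have kfin: "(\<integral>\<^sup>+x. ennreal (?k x) \<partial>M) < \<infinity>" .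
  have "AE x in M. push g h x \<noteq> \<infinity>" "AE x in M. h x \<noteq> \<infinity>"
    using fin fin' by (auto intro!: nn_integral_noteq_infinite simp del: infinity_ennreal_def)
  then have "AE x in M. min (push g h x) (h x) \<le> ennreal (?k x)"
    by eventually_elim (rule min_le_ennreal_sqrt_mult)
  then have "(\<integral>\<^sup>+x. min (push g h x) (h x) \<partial>M) \<le> (\<integral>\<^sup>+x. ennreal (?k x) \<partial>M)"
    by (rule nn_integral_mono_AE)
  with p have "ennreal p \<le> (\<integral>\<^sup>+x. ennreal (?k x) \<partial>M)" by order
  also have "\<dots> = ennreal (integral\<^sup>L M ?k)"
    using kfin by (intro nn_integral_eq_integral integrableI_nonneg) auto
  finally have "p \<le> integral\<^sup>L M ?k"
    by (subst (asm) ennreal_le_iff) auto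
  with inner show ?thesis by simp
qed

section \<open>Overlap of sums along the powers of one element\<close>

definition orbit_sum :: "'g \<Rightarrow> ('x \<Rightarrow> ennreal) \<Rightarrow> nat \<Rightarrow> 'x \<Rightarrow> ennreal" where
  "orbit_sum z f N x = (\<Sum>k<N. push (z [^] k) f x)"

lemma measurable_orbit_sum [measurable]:
  assumes "z \<in> carrier G" "f \<in> borel_measurable M"
  shows "orbit_sum z f N \<in> borel_measurable M"
  using assms unfolding orbit_sum_def[abs_def] by auto

lemma nn_integral_orbit_sum:
  assumes "z \<in> carrier G" "f \<in> borel_measurable M"
  shows "(\<integral>\<^sup>+x. orbit_sum z f N x \<partial>M) = of_nat N * (\<integral>\<^sup>+x. f x \<partial>M)"
  using assms by (simp add: orbit_sum_def nn_integral_sum nn_integral_push)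

text \<open>Both functions dominate the terms indexed by \<open>{n..<N}\<close> that the two intervals
  \<open>{..<N}\<close> and \<open>{n..<n + N}\<close> share.\<close>

lemma nn_integral_min_orbit_sum_ge:
  assumes z: "z \<in> carrier G" and f: "f \<in> borel_measurable M"
  shows "of_nat (N - n) * (\<integral>\<^sup>+x. f x \<partial>M)
    \<le> (\<integral>\<^sup>+x. min (push (z [^] n) (orbit_sum z f N) x) (orbit_sum z f N x) \<partial>M)"
proof -
  let ?I = "\<lambda>x. \<Sum>k\<in>{n..<N}. push (z [^] k) f x"
  \<comment> \<open>The exceptional null sets depend on \<open>k\<close>; their countable union is
    still null.\<close>
  have "AE x in M. \<forall>k<N. push (z [^] n) (push (z [^] k) f) x = push (z [^] (n + k)) f x"
    using z f push_push[OF nat_pow_closed[OF z] nat_pow_closed[OF z] f]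
    by (auto simp: AE_all_countable nat_pow_mult)
  then have "AE x in M. ?I x \<le> min (push (z [^] n) (orbit_sum z f N) x) (orbit_sum z f N x)"
  proof eventually_elim
    case (elim x)
    have "?I x \<le> (\<Sum>k\<in>{n..<n + N}. push (z [^] k) f x)"
      by (intro sum_mono2) auto
    also have "\<dots> = (\<Sum>k<N. push (z [^] (n + k)) f x)"
      using sum.shift_bounds_nat_ivl[of "\<lambda>k. push (z [^] k) f x" 0 n N]
      by (simp add: add.commute atLeast0LessThan)
    also have "\<dots> = push (z [^] n) (orbit_sum z f N) x"
      using elim by (simp add: orbit_sum_def[abs_def] push_sum)
    finally have "?I x \<le> push (z [^] n) (orbit_sum z f N) x" .
    moreover have "?I x \<le> orbit_sum z f N x"
      unfolding orbit_sum_def by (intro sum_mono2) auto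
    ultimately show ?case by simp
  qed
  then have "(\<integral>\<^sup>+x. ?I x \<partial>M)
      \<le> (\<integral>\<^sup>+x. min (push (z [^] n) (orbit_sum z f N) x) (orbit_sum z f N x) \<partial>M)"
    by (rule nn_integral_mono_AE)
  \<comment> \<open>Truncated subtraction is right here: the interval is empty once \<open>n\<close>
    exceeds \<open>N\<close>.\<close>
  moreover have "(\<integral>\<^sup>+x. ?I x \<partial>M) = of_nat (N - n) * (\<integral>\<^sup>+x. f x \<partial>M)"
    using z f by (simp add: nn_integral_sum nn_integral_push)
  ultimately show ?thesis by simp
qed

text \<open>Sigma-finiteness yields a strictly positive integrable function; its integral is nonzero
  because \<open>M\<close> is, so it can be normalised.\<close>

lemma ex_probability_density:
  assumes "emeasure M (space M) \<noteq> 0"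
  obtains f where "f \<in> borel_measurable M" "(\<integral>\<^sup>+x. f x \<partial>M) = 1"
proof -
  obtain h where h [measurable]: "h \<in> borel_measurable M"
    and fin: "integral\<^sup>N M h \<noteq> \<infinity>" and pos: "\<And>x. x \<in> space M \<Longrightarrow> 0 < h x"
    using Ex_finite_integrable_function by blast
  have nz: "integral\<^sup>N M h \<noteq> 0"
  proof
    assume "integral\<^sup>N M h = 0"
    then have "AE x in M. h x = 0" by (simp add: nn_integral_0_iff_AE)
    moreover have "AE x in M. h x \<noteq> 0" using pos by (intro AE_I2) force
    ultimately have "AE x in M. False" by eventually_elim simp
    with assms show False
      using AE_iff_measurable[of "space M" M "\<lambda>_. False"] by simp
  qed
  show thesis
  proof
    show "(\<integral>\<^sup>+x. h x / integral\<^sup>N M h \<partial>M) = 1"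
      using fin nz by (simp add: nn_integral_divide ennreal_divide_self less_top)
  qed measurable
qed

text \<open>As \<open>N\<close> is arbitrary, the coefficients along powers of \<open>z\<close> can
  be made to decay as slowly as desired.\<close>

lemma ex_vector_slow_coefficients:
  fixes N :: "nat \<Rightarrow> nat"
  assumes nz: "emeasure M (space M) \<noteq> 0" and z: "z \<in> carrier G"
  obtains \<xi> where "\<xi> \<in> L2_pos M"
    "\<And>j n. n \<le> N j \<Longrightarrow> (1/2) ^ (j + 2) \<le> Re (L2_inner M (koopman G M \<alpha> (z [^] n) \<xi>) \<xi>)"
proof -
  obtain f where f: "f \<in> borel_measurable M" and f1: "(\<integral>\<^sup>+x. f x \<partial>M) = 1"
    using ex_probability_density[OF nz] .
  \<comment> \<open>For \<open>n\<close> at most \<open>N j\<close>, more than half of the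
    \<open>K j\<close> terms survive a shift by \<open>n\<close>; this costs a factor 1/2, hence the
    exponent \<open>j + 2\<close>. The added 1 keeps \<open>K j\<close> positive.\<close>
  define K where "K j = 2 * N j + 1" for j
  \<comment> \<open>Normalising by \<open>K j\<close> and weighting by a geometric series of sum 1
    gives \<open>h\<close> total mass 1.\<close>
  define c where "c j = ennreal ((1/2) ^ Suc j / real (K j))" for j
  define S where "S j = orbit_sum z f (K j)" for j
  define h where "h x = suminf (\<lambda>j. c j * S j x)" for x
  have [measurable]: "S j \<in> borel_measurable M" for j
    using z f by (simp add: S_def)
  have h_meas [measurable]: "h \<in> borel_measurable M"
    unfolding h_def[abs_def] by measurable
  have K_pos: "0 < real (K j)" for j by (simp add: K_def)
  have cK: "c j * of_nat (K j) = ennreal ((1/2) ^ Suc j)" for j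
    using K_pos[of j] by (simp add: c_def ennreal_of_nat_eq_real_of_nat flip: ennreal_mult)
  have "(\<integral>\<^sup>+x. h x \<partial>M) = suminf (\<lambda>j. c j * (\<integral>\<^sup>+x. S j x \<partial>M))"
    unfolding h_def by (simp add: nn_integral_suminf nn_integral_cmult)
  also have "\<dots> = suminf (\<lambda>j. ennreal ((1/2) ^ Suc j))"
    using z f f1 cK by (simp add: S_def nn_integral_orbit_sum)
  also have "\<dots> = ennreal 1"
    using power_half_series by (intro suminf_ennreal_eq) auto
  finally have fin: "(\<integral>\<^sup>+x. h x \<partial>M) < \<infinity>" by simp
  \<comment> \<open>A single summand of \<open>h\<close> suffices for the overlap, since all
    summands are nonnegative.\<close>
  have S_le: "c j * S j x \<le> h x" for j x
    unfolding h_def using sum_le_suminf[of "\<lambda>j. c j * S j x" "{j}"] by simp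
  show thesis
  proof
    show "sqrt_density h \<in> L2_pos M"
      using h_meas fin by (rule sqrt_density_in_L2_pos)
    fix j n assume n: "n \<le> N j"
    have zn: "z [^] n \<in> carrier G" using z by simp
    have "real (K j) \<le> 2 * real (K j - n)"
      using n by (auto simp: K_def)
    then have "(1/2) ^ (j + 2) \<le> (1/2) ^ Suc j / real (K j) * real (K j - n)"
      using K_pos[of j] by (simp add: field_simps)
    then have "ennreal ((1/2) ^ (j + 2)) \<le> c j * of_nat (K j - n)"
      by (simp add: c_def ennreal_of_nat_eq_real_of_nat ennreal_leI
               flip: ennreal_mult)
    also have "\<dots> \<le> c j * (\<integral>\<^sup>+x. min (push (z [^] n) (S j) x) (S j x) \<partial>M)"
      using nn_integral_min_orbit_sum_ge[OF z f, of "K j" n] f1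
      by (intro mult_left_mono) (auto simp: S_def)
    also have "\<dots> = (\<integral>\<^sup>+x. c j * min (push (z [^] n) (S j) x) (S j x) \<partial>M)"
      using zn by (intro nn_integral_cmult[symmetric]) measurable
    also have "\<dots> \<le> (\<integral>\<^sup>+x. min (push (z [^] n) h x) (h x) \<partial>M)"
    proof (intro nn_integral_mono min.boundedI)
      fix x
      have "c j * min (push (z [^] n) (S j) x) (S j x) \<le> c j * push (z [^] n) (S j) x"
        by (intro mult_left_mono) auto
      also have "\<dots> \<le> push (z [^] n) h x"
        using push_mono[of "\<lambda>x. c j * S j x" h "z [^] n" x, OF S_le] by (simp add: push_cmult)
      finally show "c j * min (push (z [^] n) (S j) x) (S j x) \<le> push (z [^] n) h x" .
      have "c j * min (push (z [^] n) (S j) x) (S j x) \<le> c j * S j x"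
        by (intro mult_left_mono) auto
      with S_le show "c j * min (push (z [^] n) (S j) x) (S j x) \<le> h x"
        using order_trans by blast
    qed
    finally show "(1/2) ^ (j + 2)
        \<le> Re (L2_inner M (koopman G M \<alpha> (z [^] n) (sqrt_density h)) (sqrt_density h))"
      by (rule koopman_coefficient_ge[OF h_meas fin zn])
  qed
qed

end

section \<open>Counting powers of the generator in balls\<close>

text \<open>Since balls are symmetric, the nonnegative powers make up at least half of them.\<close>

lemma (in group) ex_finite_powers_in_ball:
  assumes L: "length_function G L" and z: "z \<in> carrier G"
    and growth: "exponential_growth L (range (\<lambda>n::int. z [^] n))"
  obtains a c :: real where "1 < a" "0 < c"
    "\<forall>\<^sub>F R in at_top. \<exists>F. finite F \<and> F \<subseteq> range (\<lambda>n::nat. z [^] n) \<and>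
       (\<forall>g\<in>F. L g \<le> R) \<and> c * a powr R \<le> real (card F)"
proof -
  let ?Z = "range (\<lambda>n::int. z [^] n)" and ?N = "range (\<lambda>n::nat. z [^] n)"
  obtain a c :: real where a: "a > 1" and c: "c > 0"
    and ev: "\<forall>\<^sub>F R in at_top. finite {g\<in>?Z. L g \<le> R} \<longrightarrow>
        real (card {g\<in>?Z. L g \<le> R}) \<ge> c * a powr R"
    using growth unfolding exponential_growth_def by blast
  have sub: "{g\<in>?Z. L g \<le> R} \<subseteq> {g\<in>?N. L g \<le> R} \<union> (\<lambda>g. inv g) ` {g\<in>?N. L g \<le> R}" for R
  proof
    fix g assume "g \<in> {g\<in>?Z. L g \<le> R}"
    then obtain n :: int where n: "g = z [^] n" and g: "L g \<le> R" by auto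
    show "g \<in> {g\<in>?N. L g \<le> R} \<union> (\<lambda>g. inv g) ` {g\<in>?N. L g \<le> R}"
    proof (cases n rule: int_cases2)
      case (nonneg m)
      then show ?thesis using n g by (auto simp: int_pow_int)
    next
      case (nonpos m)
      then have g': "g = inv (z [^] m)" using n z by (simp add: int_pow_neg_int)
      then have "L (z [^] m) \<le> R"
        using g L z by (auto simp: length_function_def)
      then show ?thesis using g' by blast
    qed
  qed
  show thesis
  proof
    show "1 < a" "0 < c / 2" using a c by auto
    show "\<forall>\<^sub>F R in at_top. \<exists>F. finite F \<and> F \<subseteq> ?N \<and>
       (\<forall>g\<in>F. L g \<le> R) \<and> c / 2 * a powr R \<le> real (card F)"
      using ev
    proof eventually_elim
      case (elim R)
      let ?B = "{g\<in>?N. L g \<le> R}"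
      show ?case
      \<comment> \<open>If \<open>?B\<close> is finite, so is the full ball, and the growth bound
        applies to it. If \<open>?B\<close> is infinite, it contains finite sets of any prescribed
        size.\<close>
      proof (cases "finite ?B")
        case True
        then have fin: "finite {g\<in>?Z. L g \<le> R}"
          by (intro finite_subset[OF sub]) simp
        have "card {g\<in>?Z. L g \<le> R} \<le> card (?B \<union> (\<lambda>g. inv g) ` ?B)"
          using True sub by (intro card_mono) auto
        also have "\<dots> \<le> card ?B + card ?B"
          using card_Un_le card_image_le[OF True] by (metis (no_types, lifting) add_left_mono order_trans)
        finally show ?thesis
          using elim fin True by (intro exI[of _ ?B]) auto
      next
        case False
        then obtain F where F: "finite F" "card F = nat \<lceil>c / 2 * a powr R\<rceil>" "F \<subseteq> ?B"
          using infinite_arbitrarily_large[OF False, of "nat \<lceil>c / 2 * a powr R\<rceil>"] by blast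
        have "c / 2 * a powr R \<le> real (card F)"
          unfolding F(2) by (rule real_nat_ceiling_ge)
        with F(1,3) show ?thesis by blast
      qed
    qed
  qed
qed

section \<open>Divergence of the series\<close>

theorem theorem1p1:
  fixes G :: "('g, 'r) monoid_scheme"
    and L :: "'g \<Rightarrow> real"
    and M :: "'x measure"
    and \<alpha> :: "'g \<Rightarrow> 'x \<Rightarrow> 'x"
    and Z :: "'g set"
  assumes "group G"
    and "countable (carrier G)"
    and "length_function G L"
    and "sigma_finite_measure M"
    and "emeasure M (space M) \<noteq> 0"
    and "measurable_action G M \<alpha>"
    and "quasi_invariant G M \<alpha>"
    and "subgroup Z G"
    and "cyclic_group (subgroup_generated G Z)"
    and "exponential_growth L Z"
  shows "\<exists>\<xi>\<in>L2_pos M. \<forall>d::real. d \<ge> 1 \<longrightarrow>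
    (\<Sum>\<^sub>\<infinity>\<gamma>\<in>carrier G.
       ennreal (Re ((L2_inner M (koopman G M \<alpha> \<gamma> \<xi>) \<xi>)\<^sup>2) / (1 + L \<gamma>) powr d)) = \<infinity>"
proof -
  interpret quasi_invariant_action G M \<alpha>
    using assms by (simp add: quasi_invariant_action_def quasi_invariant_action_axioms_def)
  interpret sub: group "subgroup_generated G Z" by simp
  obtain z where z: "z \<in> Z" and Z: "Z = range (\<lambda>n::int. z [^]\<^bsub>G\<^esub> n)"
    using assms(9) \<open>subgroup Z G\<close>
    by (auto simp: sub.cyclic_group int_pow_subgroup_generated subgroup.carrier_subgroup_generated_subgroup)
  have zG: "z \<in> carrier G" using z \<open>subgroup Z G\<close> subgroup.subset by blast
  obtain a c :: real where a: "1 < a" and c: "0 < c"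
    and ev: "\<forall>\<^sub>F R in at_top. \<exists>F. finite F \<and> F \<subseteq> range (\<lambda>n::nat. z [^]\<^bsub>G\<^esub> n) \<and>
       (\<forall>g\<in>F. L g \<le> R) \<and> c * a powr R \<le> real (card F)"
    using ex_finite_powers_in_ball[OF \<open>length_function G L\<close> zG \<open>exponential_growth L Z\<close>[unfolded Z]] .
  \<comment> \<open>The squared coefficients lose a factor 4 per step in \<open>j\<close>. Radius
    \<open>j\<close> would compensate only for large \<open>a\<close>; a quadratic radius does so
    for every \<open>a > 1\<close>.\<close>
  have "filterlim (\<lambda>j. (real j)\<^sup>2) at_top sequentially" by real_asymp
  then have "\<forall>\<^sub>F j in sequentially. \<exists>F. finite F \<and> F \<subseteq> range (\<lambda>n::nat. z [^]\<^bsub>G\<^esub> n) \<and>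
       (\<forall>g\<in>F. L g \<le> (real j)\<^sup>2) \<and> c * a powr ((real j)\<^sup>2) \<le> real (card F)"
    by (rule eventually_compose_filterlim[OF ev])
  then obtain F where F: "\<forall>\<^sub>F j in sequentially. finite (F j) \<and> F j \<subseteq> range (\<lambda>n::nat. z [^]\<^bsub>G\<^esub> n) \<and>
       (\<forall>g\<in>F j. L g \<le> (real j)\<^sup>2) \<and> c * a powr ((real j)\<^sup>2) \<le> real (card (F j))"
    unfolding eventually_ex by blast
  \<comment> \<open>A finite set of powers uses bounded exponents. The implication covers the small
    \<open>j\<close>, where nothing is known about \<open>F j\<close>. Neither \<open>F\<close> nor
    \<open>N\<close> involves \<open>d\<close>, so one vector serves all \<open>d\<close>.\<close>
  have "\<exists>N. finite (F j) \<and> F j \<subseteq> range (\<lambda>n::nat. z [^]\<^bsub>G\<^esub> n) \<longrightarrow> F j \<subseteq> (\<lambda>n::nat. z [^]\<^bsub>G\<^esub> n) ` {..N}" for j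
  proof (cases "finite (F j) \<and> F j \<subseteq> range (\<lambda>n::nat. z [^]\<^bsub>G\<^esub> n)")
    case True
    then obtain A :: "nat set" where A: "finite A" "F j = (\<lambda>n::nat. z [^]\<^bsub>G\<^esub> n) ` A"
      using finite_subset_image[of "F j" "\<lambda>n::nat. z [^]\<^bsub>G\<^esub> n" "UNIV :: nat set"] by blast
    from A(1) have "A \<subseteq> {..Max A}" by auto
    then have "F j \<subseteq> (\<lambda>n::nat. z [^]\<^bsub>G\<^esub> n) ` {..Max A}"
      unfolding A(2) by (rule image_mono)
    then show ?thesis by blast
  next
    case False
    then show ?thesis by blast
  qed
  then have "\<exists>N. \<forall>j. finite (F j) \<and> F j \<subseteq> range (\<lambda>n::nat. z [^]\<^bsub>G\<^esub> n) \<longrightarrow>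
      F j \<subseteq> (\<lambda>n::nat. z [^]\<^bsub>G\<^esub> n) ` {..N j}"
    by (intro choice allI)
  then obtain N where N: "\<And>j. finite (F j) \<Longrightarrow> F j \<subseteq> range (\<lambda>n::nat. z [^]\<^bsub>G\<^esub> n) \<Longrightarrow>
      F j \<subseteq> (\<lambda>n::nat. z [^]\<^bsub>G\<^esub> n) ` {..N j}"
    by blast
  obtain \<xi> where \<xi>: "\<xi> \<in> L2_pos M" and coeff: "\<And>j n. n \<le> N j \<Longrightarrow>
      (1/2) ^ (j + 2) \<le> Re (L2_inner M (koopman G M \<alpha> (z [^]\<^bsub>G\<^esub> n) \<xi>) \<xi>)"
    by (rule ex_vector_slow_coefficients[OF \<open>emeasure M (space M) \<noteq> 0\<close> zG, of N]) blast
  let ?t = "\<lambda>d \<gamma>. Re ((L2_inner M (koopman G M \<alpha> \<gamma> \<xi>) \<xi>)\<^sup>2) / (1 + L \<gamma>) powr d"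
  have "(\<Sum>\<^sub>\<infinity>\<gamma>\<in>carrier G. ennreal (?t d \<gamma>)) = \<infinity>" if d: "d \<ge> 1" for d :: real
  proof -
    \<comment> \<open>The lower bound for the size of \<open>F j\<close> times a lower bound for
      each term on it.\<close>
    let ?b = "\<lambda>j::nat. c * a powr ((real j)\<^sup>2) * ((1/4) ^ (j + 2) / (1 + (real j)\<^sup>2) powr d)"
    have upper: "\<forall>\<^sub>F j in sequentially. ennreal (?b j) \<le> (\<Sum>\<^sub>\<infinity>\<gamma>\<in>carrier G. ennreal (?t d \<gamma>))"
      using F
    proof eventually_elim
      case (elim j)
      have FG: "F j \<subseteq> carrier G" using elim zG by auto
      have t: "(1/4) ^ (j + 2) / (1 + (real j)\<^sup>2) powr d \<le> ?t d \<gamma>" if \<gamma>: "\<gamma> \<in> F j" for \<gamma>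
      proof -
        let ?q = "L2_inner M (koopman G M \<alpha> \<gamma> \<xi>) \<xi>"
        have "?q \<in> \<real>\<^sub>\<ge>\<^sub>0"
          using FG \<gamma> by (intro koopman_coefficient_nonneg[OF \<open>group G\<close> action quasi_inv _ \<xi>]) auto
        then have sq: "Re (?q\<^sup>2) = (Re ?q)\<^sup>2"
          by (simp add: complex_nonneg_Reals_iff)
        obtain n where "n \<le> N j" "\<gamma> = z [^]\<^bsub>G\<^esub> n"
          using N[of j] elim \<gamma> by blast
        then have "(1/2) ^ (j + 2) \<le> Re ?q"
          using coeff by simp
        then have "((1/2) ^ (j + 2))\<^sup>2 \<le> (Re ?q)\<^sup>2"
          by (intro power_mono) auto
        moreover have "((1/2::real) ^ (j + 2))\<^sup>2 = (1/4) ^ (j + 2)"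
          by (simp add: power2_eq_square flip: power_mult_distrib)
        moreover have "0 \<le> L \<gamma>" "L \<gamma> \<le> (real j)\<^sup>2"
          using elim \<gamma> FG \<open>length_function G L\<close> by (auto simp: length_function_def)
        ultimately show ?thesis
          unfolding sq using d by (intro frac_le powr_mono2) auto
      qed
      have "?b j \<le> real (card (F j)) * ((1/4) ^ (j + 2) / (1 + (real j)\<^sup>2) powr d)"
        using elim by (intro mult_right_mono) auto
      also have "\<dots> \<le> (\<Sum>\<gamma>\<in>F j. ?t d \<gamma>)"
        using t by (intro sum_bounded_below) auto
      finally have "ennreal (?b j) \<le> ennreal (\<Sum>\<gamma>\<in>F j. ?t d \<gamma>)" by (rule ennreal_leI)
      also have "\<dots> = (\<Sum>\<gamma>\<in>F j. ennreal (?t d \<gamma>))"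
        using t by (intro sum_ennreal[symmetric])
          (meson divide_nonneg_nonneg order_trans powr_ge_zero
            zero_le_power zero_le_divide_1_iff zero_le_numeral)
      \<comment> \<open>An infinite sum in \<open>ennreal\<close> is the supremum of its finite
        partial sums.\<close>
      also have "\<dots> \<le> (\<Sum>\<^sub>\<infinity>\<gamma>\<in>carrier G. ennreal (?t d \<gamma>))"
        using elim FG by (subst nonneg_infsum_complete) (auto intro!: SUP_upper)
      finally show ?case .
    qed
    have "filterlim ?b at_top sequentially"
      using a c by real_asymp
    then have lim: "(\<lambda>j. ennreal (?b j)) \<longlonglongrightarrow> \<infinity>"
      by (simp add: ennreal_tendsto_top_eq_at_top)
    have "\<infinity> \<le> (\<Sum>\<^sub>\<infinity>\<gamma>\<in>carrier G. ennreal (?t d \<gamma>))"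
      by (rule tendsto_upperbound[OF lim upper]) simp
    then show ?thesis by (simp add: top_unique)
  qed
  with \<xi> show ?thesis by blast
qed

end
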